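(* Let $X$ be the geometric realization of the graph with vertex set $V=\{a,b,c,d,e\}$ and edge set $E=\{ab,ac,ad,ae,bc,bd,be,cd,ce\}$ (the $1$-skeleton of a triangular bipyramid), and let $f:X\to[0,\infty)$ be the function that is linear on each edge with vertex values $f(d)=f(e)=3$ and $f(a)=f(b)=f(c)=1$. Then the unimodal $\infty$-category of $f$ is $\mathbf{ucat}^\infty(f)=2$.
   Context: A continuous function $u:X\to[0,\infty)$ on a topological space is unimodal if there is $M>0$ such that the superlevel set $u^{-1}[c,\infty)$ is contractible for $0<c\le M$ and empty for $c>M$. The unimodal $\infty$-category $\mathbf{ucat}^\infty(f)$ of $f:X\to[0,\infty)$ is the minimum number $n$ of unimodal functions $u_1,\dots,u_n:X\to[0,\infty)$ such that pointwise $f=\max_{1\le i\le n}u_i$. Here $xy$ is shorthand for the edge $\{x,y\}$. *)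

theory Defs
  imports "HOL-Analysis.Analysis" "HOL-Library.Extended_Nat"
begin

(* contractible_space holds of the empty space in HOL-Analysis; contractible spaces are
   nonempty here, hence the extra conjunct. *)
definition unimodal :: "'a topology \<Rightarrow> ('a \<Rightarrow> real) \<Rightarrow> bool" where
  "unimodal X u \<longleftrightarrow>
     continuous_map X (top_of_set {0..}) u \<and>
     (\<exists>M>0. \<forall>c.
        (0 < c \<and> c \<le> M \<longrightarrow>
           {x \<in> topspace X. c \<le> u x} \<noteq> {} \<and>
           contractible_space (subtopology X {x \<in> topspace X. c \<le> u x})) \<and>
        (c > M \<longrightarrow> {x \<in> topspace X. c \<le> u x} = {}))"

(* Unimodal functions are nonnegative, so inserting 0 only fixes the value 0 of the empty
   maximum (n = 0). The infimum is attained, or is infinite if f has no such decomposition. *)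
definition ucat_infty :: "'a topology \<Rightarrow> ('a \<Rightarrow> real) \<Rightarrow> enat" where
  "ucat_infty X f =
     Inf {enat n | n. \<exists>u :: nat \<Rightarrow> 'a \<Rightarrow> real.
            (\<forall>i\<in>{1..n}. unimodal X (u i)) \<and>
            (\<forall>x\<in>topspace X. f x = Max (insert 0 ((\<lambda>i. u i x) ` {1..n})))}"

definition vertex_point :: "'v::finite \<Rightarrow> real ^ 'v" where
  "vertex_point v = axis v 1"

definition graph_realization :: "'v::finite set \<Rightarrow> 'v set set \<Rightarrow> (real ^ 'v) topology" where
  "graph_realization V E =
     top_of_set (vertex_point ` V \<union> (\<Union>e\<in>E. convex hull (vertex_point ` e)))"

(* "Linear" in the sense of linear interpolation between the two endpoint values. *)
definition linear_on_edges :: "'v::finite set set \<Rightarrow> (real ^ 'v \<Rightarrow> real) \<Rightarrow> bool" where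
  "linear_on_edges E f \<longleftrightarrow>
     (\<forall>v w. \<forall>s\<in>{0..1}. {v, w} \<in> E \<longrightarrow>
        f ((1 - s) *\<^sub>R vertex_point v + s *\<^sub>R vertex_point w) =
        (1 - s) * f (vertex_point v) + s * f (vertex_point w))"

datatype vertex = Va | Vb | Vc | Vd | Ve

lemma UNIV_vertex: "UNIV = {Va, Vb, Vc, Vd, Ve}"
  using vertex.exhaust by blast

instance vertex :: finite
  by standard (simp add: UNIV_vertex)

definition bipyramid_vertices :: "vertex set" where
  "bipyramid_vertices = {Va, Vb, Vc, Vd, Ve}"

definition bipyramid_edges :: "vertex set set" where
  "bipyramid_edges =
     {{Va, Vb}, {Va, Vc}, {Va, Vd}, {Va, Ve}, {Vb, Vc}, {Vb, Vd}, {Vb, Ve}, {Vc, Vd}, {Vc, Ve}}"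

end

theory Submission
  imports Defs
begin

text \<open>
  On the whole realization \<^term>\<open>X\<close> the function is \<^term>\<open>f x = 1 + 2 * x $ Vd + 2 * x $ Ve\<close> in
  barycentric coordinates. A single unimodal function cannot be \<^term>\<open>f\<close>: the set where \<^term>\<open>f\<close>
  is at least 3 contains both apices \<^term>\<open>Vd\<close> and \<^term>\<open>Ve\<close>, but it misses every point with
  coordinate 1/2 at \<^term>\<open>Vd\<close>, so it is disconnected (\<open>not_unimodal_two_maxima\<close>).

  For two functions, one peak is placed at each apex. The first function equals \<^term>\<open>f\<close> on the
  edges at \<^term>\<open>Vd\<close> and falls linearly from 1 to 0 along the edges towards \<^term>\<open>Ve\<close>; the second
  does the same with the apices exchanged. The difficulty is the base triangle, on which
  \<^term>\<open>f\<close> is constantly 1: a superlevel set of the first function contains the tripod from \<^term>\<open>Vd\<close> to the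
  three base vertices, so if it also contained a whole base edge it would contain a cycle. Hence
  each function must drop to 0 somewhere on each base edge, and where one drops, the other has to
  be 1. So the dips of the first function sit in the second half of each edge, for a cyclic
  orientation of the triangle, and those of the second function in the first half. Then the maximum
  is \<^term>\<open>f\<close> (\<open>max_peaks\<close>). The second function is the first one with the apices exchanged and the
  orientation reversed, so one proof of unimodality (\<open>unimodal_peak\<close>) serves both.

  A superlevel set of such a peak is a tripod at the upper apex, truncated for levels above 1; for
  levels at most 1 it is the whole tripod, with whiskers growing from its feet along the
  remaining edges. Opposite whiskers on a base edge do not meet as long as the level is positive, so
  the set is a tree. It is contractible because segments glued at single points are absolute
  retracts (\<open>AR_wedge\<close>, \<open>AR_stars\<close>).
\<close>

section \<open>Gluing absolute retracts at a point\<close>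

text \<open>
  The induction is on the number of pieces, with \<open>AR_closed_Un\<close> and the fact that a point is an
  absolute retract. Contractibility alone would not be preserved: two closed contractible sets that
  share one point can have a union that is not contractible.
\<close>

lemma AR_wedge:
  fixes S :: "'i \<Rightarrow> 'a::euclidean_space set"
  assumes "finite I" "I \<noteq> {}"
    and "\<And>i. i \<in> I \<Longrightarrow> AR (S i)" "\<And>i. i \<in> I \<Longrightarrow> closed (S i)" "\<And>i. i \<in> I \<Longrightarrow> p \<in> S i"
    and "\<And>i j. \<lbrakk>i \<in> I; j \<in> I; i \<noteq> j\<rbrakk> \<Longrightarrow> S i \<inter> S j \<subseteq> {p}"
  shows "AR (\<Union>i\<in>I. S i)"
  using assms
proof (induction I rule: finite_ne_induct)
  case (singleton i)
  then show ?case by simp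
next
  case (insert i I)
  have meet: "S i \<inter> (\<Union>j\<in>I. S j) = {p}"
  proof
    show "S i \<inter> (\<Union>j\<in>I. S j) \<subseteq> {p}"
      using insert.prems(4) insert.hyps(3) by fastforce
    show "{p} \<subseteq> S i \<inter> (\<Union>j\<in>I. S j)"
      using insert.prems(3) insert.hyps(2) by auto
  qed
  have "AR (\<Union>j\<in>I. S j)"
    using insert.IH insert.prems by blast
  moreover have "closed (\<Union>j\<in>I. S j)"
    using insert.hyps(1) insert.prems(2) by (auto intro: closed_UN)
  ultimately have "AR (S i \<union> (\<Union>j\<in>I. S j))"
    using insert.prems(1,2) meet by (intro AR_closed_Un) (auto simp: AR_singleton)
  then show ?case by simp
qed

section \<open>Stars of partial edges\<close>

text \<open>
  For \<open>0 \<le> s \<le> 1\<close>, the initial piece of length \<^term>\<open>s\<close> of the edge from \<^term>\<open>v\<close> to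
  \<^term>\<open>w\<close>. Giving it by linear conditions on the coordinates makes it convex and closed at
  sight, and reduces intersections and superlevel sets to comparisons of coordinates.
\<close>
definition partial_edge :: "'v::finite \<Rightarrow> 'v \<Rightarrow> real \<Rightarrow> (real ^ 'v) set" where
  "partial_edge v w s =
     {x. x $ v = 1 - x $ w \<and> 0 \<le> x $ w \<and> x $ w \<le> s \<and> (\<forall>u. u \<noteq> v \<longrightarrow> u \<noteq> w \<longrightarrow> x $ u = 0)}"

lemma convex_partial_edge: "convex (partial_edge v w s)"
proof (rule convexI)
  fix x y :: "real ^ 'a" and p q :: real
  assume *: "x \<in> partial_edge v w s" "y \<in> partial_edge v w s" "0 \<le> p" "0 \<le> q" "p + q = 1"
  have "p * x $ w + q * y $ w \<le> p * s + q * s"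
    using * by (intro add_mono mult_left_mono) (auto simp: partial_edge_def)
  also have "\<dots> = s" using *(5) by (metis distrib_right mult_1)
  finally have "p * x $ w + q * y $ w \<le> s" .
  moreover have "p * x $ v + q * y $ v = (p + q) - (p * x $ w + q * y $ w)"
  proof -
    have "x $ v = 1 - x $ w" "y $ v = 1 - y $ w" using * by (auto simp: partial_edge_def)
    then show ?thesis by (simp only:) (simp add: algebra_simps)
  qed
  ultimately show "p *\<^sub>R x + q *\<^sub>R y \<in> partial_edge v w s"
    using * by (simp add: partial_edge_def)
qed

lemma closed_partial_edge: "closed (partial_edge v w s)"
  unfolding partial_edge_def
  by (intro closed_Collect_conj closed_Collect_all closed_Collect_imp closed_Collect_eq
      closed_Collect_le continuous_intros open_Collect_const)

lemma partial_edge_ends: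
  assumes "v \<noteq> w"
  shows vertex_point_in_partial_edge: "0 \<le> s \<Longrightarrow> vertex_point v \<in> partial_edge v w s"
    and vertex_point_in_partial_edge': "1 \<le> s \<Longrightarrow> vertex_point w \<in> partial_edge v w s"
  using assms by (auto simp: partial_edge_def vertex_point_def axis_def)

lemma partial_edge_support: "\<lbrakk>x \<in> partial_edge v w s; x $ u \<noteq> 0\<rbrakk> \<Longrightarrow> u = v \<or> u = w"
  by (auto simp: partial_edge_def)

lemma partial_edge_point:
  assumes "v \<noteq> w" "x \<in> partial_edge v w s"
  shows "x = (1 - x $ w) *\<^sub>R vertex_point v + x $ w *\<^sub>R vertex_point w"
  using assms by (auto simp: partial_edge_def vertex_point_def axis_def vec_eq_iff)

text \<open>Partial edges that leave \<^term>\<open>v\<close> towards different vertices have only \<^term>\<open>v\<close> in common.\<close>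
lemma AR_star:
  assumes "W \<noteq> {}" "v \<notin> W" "\<And>w. w \<in> W \<Longrightarrow> 0 \<le> l w"
  shows "AR (\<Union>w\<in>W. partial_edge v w (l w))"
proof (rule AR_wedge[where p = "vertex_point v"])
  fix w assume w: "w \<in> W"
  show p: "vertex_point v \<in> partial_edge v w (l w)"
    using assms w by (intro vertex_point_in_partial_edge) auto
  show "AR (partial_edge v w (l w))"
    using p by (intro convex_imp_AR convex_partial_edge) auto
  show "closed (partial_edge v w (l w))" by (rule closed_partial_edge)
next
  fix w w' assume w: "w \<in> W" "w' \<in> W" "w \<noteq> w'"
  show "partial_edge v w (l w) \<inter> partial_edge v w' (l w') \<subseteq> {vertex_point v}"
  proof
    fix x assume x: "x \<in> partial_edge v w (l w) \<inter> partial_edge v w' (l w')"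
    have "x $ w = 0" using x w assms(2) by (auto simp: partial_edge_def)
    moreover have "v \<noteq> w" using w assms(2) by auto
    ultimately have "x = vertex_point v" using partial_edge_point[of v w x "l w"] x by simp
    then show "x \<in> {vertex_point v}" by simp
  qed
qed (use assms(1) in simp_all)

definition stars :: "'v::finite set \<Rightarrow> 'v set \<Rightarrow> ('v \<Rightarrow> 'v \<Rightarrow> real) \<Rightarrow> (real ^ 'v) set" where
  "stars K U l = (\<Union>v\<in>K. \<Union>w\<in>U - {v}. partial_edge v w (l v w))"

text \<open>
  If all edges from \<^term>\<open>K\<close> to a hub \<^term>\<open>d\<close> are complete, the others are too short to reach
  their far end, and opposite pieces on an edge inside \<^term>\<open>K\<close> leave a gap, then the star at
  \<^term>\<open>v\<close> is positive at the coordinate \<^term>\<open>v\<close> except at the hub. A common point of the stars at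
  \<^term>\<open>v\<close> and \<^term>\<open>v'\<close> other than the hub would thus lie on the edge between \<^term>\<open>v\<close> and \<^term>\<open>v'\<close>,
  in both opposite pieces, and the gap excludes this. So the stars form a wedge at the hub.
\<close>
lemma AR_stars:
  assumes "K \<noteq> {}" "d \<in> U" "d \<notin> K"
    and hub: "\<And>v. v \<in> K \<Longrightarrow> l v d = 1"
    and nonneg: "\<And>v w. v \<in> K \<Longrightarrow> w \<in> U \<Longrightarrow> 0 \<le> l v w"
    and short: "\<And>v w. v \<in> K \<Longrightarrow> w \<in> U \<Longrightarrow> w \<noteq> v \<Longrightarrow> w \<noteq> d \<Longrightarrow> l v w < 1"
    and gap: "\<And>v w. v \<in> K \<Longrightarrow> w \<in> K \<Longrightarrow> v \<noteq> w \<Longrightarrow> l v w + l w v < 1"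
  shows "AR (stars K U l)"
  unfolding stars_def
proof (rule AR_wedge[where p = "vertex_point d"])
  fix v assume v: "v \<in> K"
  show "AR (\<Union>w\<in>U - {v}. partial_edge v w (l v w))"
    using assms v by (intro AR_star) auto
  show "closed (\<Union>w\<in>U - {v}. partial_edge v w (l v w))"
    by (intro closed_UN ballI closed_partial_edge) auto
  have "vertex_point d \<in> partial_edge v d (l v d)"
    using assms v by (intro vertex_point_in_partial_edge') auto
  then show "vertex_point d \<in> (\<Union>w\<in>U - {v}. partial_edge v w (l v w))"
    using assms v by blast
next
  have positive: "x = vertex_point d \<or> 0 < x $ v"
    if x: "x \<in> partial_edge v w (l v w)" and vw: "v \<in> K" "w \<in> U - {v}" for x v w
  proof (cases "x $ w < 1")
    case True
    then show ?thesis using x by (auto simp: partial_edge_def)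
  next
    case False
    moreover have short_enough: "x $ w \<le> l v w" using x by (simp add: partial_edge_def)
    ultimately have "\<not> l v w < 1" by linarith
    then have "w = d" using short[of v w] vw by blast
    then have "x $ w = 1" using short_enough hub[OF vw(1)] False by simp
    then have "x = vertex_point d"
      using partial_edge_point[of v w x "l v w"] x vw(2) \<open>w = d\<close> by auto
    then show ?thesis ..
  qed
  fix v v' assume v: "v \<in> K" "v' \<in> K" "v \<noteq> v'"
  show "(\<Union>w\<in>U - {v}. partial_edge v w (l v w)) \<inter> (\<Union>w\<in>U - {v'}. partial_edge v' w (l v' w))
          \<subseteq> {vertex_point d}"
  proof
    fix x assume "x \<in> (\<Union>w\<in>U - {v}. partial_edge v w (l v w)) \<inter> (\<Union>w\<in>U - {v'}. partial_edge v' w (l v' w))"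
    then obtain w w' where w: "w \<in> U" "w \<noteq> v" "x \<in> partial_edge v w (l v w)"
      and w': "w' \<in> U" "w' \<noteq> v'" "x \<in> partial_edge v' w' (l v' w')"
      by blast
    have "x = vertex_point d"
    proof (rule ccontr)
      assume "x \<noteq> vertex_point d"
      then have "0 < x $ v" "0 < x $ v'"
        using positive[OF w(3) v(1)] positive[OF w'(3) v(2)] w(1,2) w'(1,2) \<open>x \<noteq> vertex_point d\<close>
        by simp_all
      then have pos: "x $ v \<noteq> 0" "x $ v' \<noteq> 0" by simp_all
      have ends: "w = v'" "w' = v" using partial_edge_support[OF w(3) pos(2)] partial_edge_support[OF w'(3) pos(1)] v(3)
        by simp_all
      have "x $ v = 1 - x $ v'" "x $ v' \<le> l v v'" "x $ v \<le> l v' v"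
        using w(3) w'(3) unfolding ends partial_edge_def mem_Collect_eq by argo+
      then show False using gap[OF v] by linarith
    qed
    then show "x \<in> {vertex_point d}" by simp
  qed
qed (use assms(1) in simp_all)

section \<open>A function on the bipyramid graph with one peak\<close>

text \<open>
  Every edge has an end in the base \<^term>\<open>{a, b, c}\<close>, so the graph is a union of stars at the base
  vertices. Edges inside the base occur twice, once in each direction; the superlevel sets are
  obtained from this description by shortening the edges.
\<close>
definition bipyramid_graph :: "'v::finite \<Rightarrow> 'v \<Rightarrow> 'v \<Rightarrow> 'v \<Rightarrow> 'v \<Rightarrow> (real ^ 'v) set" where
  "bipyramid_graph a b c d e = stars {a, b, c} {a, b, c, d, e} (\<lambda>v w. 1)"

text \<open>
  On the edge from \<^term>\<open>v\<close> to \<^term>\<open>w\<close>, a tent of height 1 over the half next to \<^term>\<open>w\<close>; zero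
  on every other edge.
\<close>
definition dip :: "'v::finite \<Rightarrow> 'v \<Rightarrow> real ^ 'v \<Rightarrow> real" where
  "dip v w x = max 0 (min (4 * x $ v) (4 * x $ w - 2))"

text \<open>
  The dips lie on the second halves of the base edges, oriented from \<^term>\<open>a\<close> to \<^term>\<open>b\<close> to
  \<^term>\<open>c\<close> to \<^term>\<open>a\<close>. Exchanging \<^term>\<open>a\<close> with \<^term>\<open>b\<close> reverses this orientation and so
  moves the dips to the other halves.
\<close>
definition peak :: "'v::finite \<Rightarrow> 'v \<Rightarrow> 'v \<Rightarrow> 'v \<Rightarrow> 'v \<Rightarrow> real ^ 'v \<Rightarrow> real" where
  "peak a b c d e x = 1 + 2 * x $ d - x $ e - (dip a b x + dip b c x + dip c a x)"

text \<open>
  How far the superlevel set at level \<^term>\<open>1 - r\<close> extends along the edge from \<^term>\<open>v\<close> to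
  \<^term>\<open>w\<close>. The tent of a dip exceeds \<^term>\<open>r\<close> between the parameters \<^term>\<open>(2 + r) / 4\<close> and
  \<^term>\<open>1 - r / 4\<close>, which gives the lengths of the two pieces that remain on a base edge.
\<close>
definition reach :: "'v \<Rightarrow> 'v \<Rightarrow> 'v \<Rightarrow> 'v \<Rightarrow> 'v \<Rightarrow> real \<Rightarrow> 'v \<Rightarrow> 'v \<Rightarrow> real" where
  "reach a b c d e r v w =
     (if w = d then 1 else if w = e then r
      else if (v, w) \<in> {(a, b), (b, c), (c, a)} then (2 + r) / 4 else r / 4)"

lemma continuous_on_peak: "continuous_on S (peak a b c d e)"
  unfolding peak_def dip_def by (intro continuous_intros)

lemma dip_eq_0: "x $ v \<le> 0 \<or> x $ w \<le> 1 / 2 \<Longrightarrow> dip v w x = 0"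
  by (auto simp: dip_def)

lemma superlevel_dip:
  assumes "x $ v = 1 - x $ w" "t \<le> 1"
  shows "t \<le> 1 - dip v w x \<longleftrightarrow> x $ w \<le> (3 - t) / 4 \<or> x $ v \<le> (1 - t) / 4"
  using assms by (auto simp: dip_def max_def min_def field_simps)

text \<open>On an edge all coordinates but two vanish, so at most one of the three dips is not zero.\<close>
lemma peak_on_edge:
  assumes "distinct [a, b, c, d, e]" "v \<in> {a, b, c}" "w \<in> {a, b, c, d, e}" "w \<noteq> v"
    and "x \<in> partial_edge v w 1"
  shows "peak a b c d e x =
    (if w = d then 1 + 2 * x $ w else if w = e then 1 - x $ w
     else if (v, w) \<in> {(a, b), (b, c), (c, a)} then 1 - dip v w x else 1 - dip w v x)"
  using assms by (auto simp: peak_def partial_edge_def dip_eq_0)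

lemma reach_simps:
  assumes "distinct [a, b, c, d, e]"
  shows "(v, w) \<in> {(a, b), (b, c), (c, a)} \<Longrightarrow> reach a b c d e r v w = (2 + r) / 4"
    and "(w, v) \<in> {(a, b), (b, c), (c, a)} \<Longrightarrow> reach a b c d e r v w = r / 4"
    and "reach a b c d e r v d = 1"
    and "reach a b c d e r v e = r"
  using assms by (auto simp: reach_def)

lemma reach_bounds:
  assumes "distinct [a, b, c, d, e]" "0 \<le> r" "r < 1"
  shows "0 \<le> reach a b c d e r v w"
    and "w \<noteq> d \<Longrightarrow> reach a b c d e r v w < 1"
    and "reach a b c d e r v w \<le> 1"
    and "\<lbrakk>v \<in> {a, b, c}; w \<in> {a, b, c}; v \<noteq> w\<rbrakk> \<Longrightarrow> reach a b c d e r v w + reach a b c d e r w v < 1"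
proof -
  show "0 \<le> reach a b c d e r v w" "w \<noteq> d \<Longrightarrow> reach a b c d e r v w < 1"
    "reach a b c d e r v w \<le> 1"
    using assms(2,3) by (simp_all add: reach_def)
  assume "v \<in> {a, b, c}" "w \<in> {a, b, c}" "v \<noteq> w"
  then consider "(v, w) \<in> {(a, b), (b, c), (c, a)}" | "(w, v) \<in> {(a, b), (b, c), (c, a)}"
    by blast
  then show "reach a b c d e r v w + reach a b c d e r w v < 1"
  proof cases
    case 1
    show ?thesis
      using reach_simps(1)[OF assms(1) 1, of r] reach_simps(2)[OF assms(1) 1, of r] assms(3) by simp
  next
    case 2
    show ?thesis
      using reach_simps(1)[OF assms(1) 2, of r] reach_simps(2)[OF assms(1) 2, of r] assms(3) by simp
  qed
qed

lemma superlevel_on_edge: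
  assumes "distinct [a, b, c, d, e]" "v \<in> {a, b, c}" "w \<in> {a, b, c, d, e}" "w \<noteq> v"
    and "x \<in> partial_edge v w 1" "t \<le> 1"
  shows "t \<le> peak a b c d e x \<longleftrightarrow>
    x $ w \<le> reach a b c d e (1 - t) v w \<or>
    w \<in> {a, b, c} \<and> x $ v \<le> reach a b c d e (1 - t) w v"
proof -
  have x: "x $ v = 1 - x $ w" "x $ w = 1 - x $ v" "0 \<le> x $ w" "x $ w \<le> 1"
    using assms(5) by (auto simp: partial_edge_def)
  have dips: "t \<le> 1 - dip v w x \<longleftrightarrow> x $ w \<le> (3 - t) / 4 \<or> x $ v \<le> (1 - t) / 4"
    "t \<le> 1 - dip w v x \<longleftrightarrow> x $ v \<le> (3 - t) / 4 \<or> x $ w \<le> (1 - t) / 4"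
    using superlevel_dip x assms(6) by blast+
  consider "w = d" | "w = e" | "(v, w) \<in> {(a, b), (b, c), (c, a)}"
    | "(w, v) \<in> {(a, b), (b, c), (c, a)}"
    using assms(2-4) by blast
  then show ?thesis
  proof cases
    case 1
    have "d \<notin> {a, b, c}" "e \<noteq> d" using assms(1) by auto
    then show ?thesis using peak_on_edge[OF assms(1-5)] x assms(6) 1 by (simp add: reach_def)
  next
    case 2
    have "e \<notin> {a, b, c}" "e \<noteq> d" using assms(1) by auto
    then show ?thesis using peak_on_edge[OF assms(1-5)] 2 by (simp add: reach_def) linarith
  next
    case 3
    have "w \<noteq> d" "w \<noteq> e" using 3 assms(1) by auto
    then have "peak a b c d e x = 1 - dip v w x"
      using peak_on_edge[OF assms(1-5)] 3 by simp
    moreover have "reach a b c d e (1 - t) v w = (3 - t) / 4"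
      "reach a b c d e (1 - t) w v = (1 - t) / 4"
      using reach_simps(1)[OF assms(1) 3, of "1 - t"] reach_simps(2)[OF assms(1) 3, of "1 - t"]
      by simp_all
    moreover have "w \<in> {a, b, c}" using 3 by auto
    ultimately show ?thesis using dips(1) by presburger
  next
    case 4
    have "w \<noteq> d" "w \<noteq> e" "(v, w) \<notin> {(a, b), (b, c), (c, a)}" using 4 assms(1) by auto
    then have "peak a b c d e x = 1 - dip w v x"
      using peak_on_edge[OF assms(1-5)] by (simp del: insert_iff)
    moreover have "reach a b c d e (1 - t) w v = (3 - t) / 4"
      "reach a b c d e (1 - t) v w = (1 - t) / 4"
      using reach_simps(1)[OF assms(1) 4, of "1 - t"] reach_simps(2)[OF assms(1) 4, of "1 - t"]
      by simp_all
    moreover have "w \<in> {a, b, c}" using 4 by auto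
    ultimately show ?thesis using dips(2) by (simp only: simp_thms disj_commute)
  qed
qed

text \<open>
  A point of a base edge that lies in the superlevel set is on one of the two sides of the dip; the
  side decides whether the star at the one end of the edge or at the other end contains it.
\<close>
lemma peak_superlevel_low:
  assumes "distinct [a, b, c, d, e]" "t \<le> 1" "0 < t"
  shows "{x \<in> bipyramid_graph a b c d e. t \<le> peak a b c d e x} =
         stars {a, b, c} {a, b, c, d, e} (reach a b c d e (1 - t))" (is "?L = ?R")
proof
  let ?l = "reach a b c d e (1 - t)"
  show "?L \<subseteq> ?R"
  proof
    fix x assume "x \<in> ?L"
    then obtain v w where vw: "v \<in> {a, b, c}" "w \<in> {a, b, c, d, e}" "w \<noteq> v"
      and x: "x \<in> partial_edge v w 1" and t: "t \<le> peak a b c d e x"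
      unfolding bipyramid_graph_def stars_def by blast
    then have "x $ w \<le> ?l v w \<or> w \<in> {a, b, c} \<and> x $ v \<le> ?l w v"
      using superlevel_on_edge[OF assms(1) vw x assms(2)] by blast
    then have "x \<in> partial_edge v w (?l v w) \<or> w \<in> {a, b, c} \<and> x \<in> partial_edge w v (?l w v)"
      using x by (auto simp: partial_edge_def)
    then show "x \<in> ?R" using vw unfolding stars_def by blast
  qed
  show "?R \<subseteq> ?L"
  proof
    fix x assume "x \<in> ?R"
    then obtain v w where vw: "v \<in> {a, b, c}" "w \<in> {a, b, c, d, e}" "w \<noteq> v"
      and x: "x \<in> partial_edge v w (?l v w)"
      unfolding stars_def by blast
    have "?l v w \<le> 1" using reach_bounds(3)[OF assms(1)] assms(2,3) by simp
    then have x1: "x \<in> partial_edge v w 1" using x by (auto simp: partial_edge_def)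
    moreover have "t \<le> peak a b c d e x"
      using superlevel_on_edge[OF assms(1) vw x1 assms(2)] x by (simp add: partial_edge_def)
    ultimately show "x \<in> ?L" using vw unfolding bipyramid_graph_def stars_def by blast
  qed
qed

lemma dip_nonneg: "0 \<le> dip v w x"
  by (simp add: dip_def)

lemma peak_superlevel_high:
  assumes "distinct [a, b, c, d, e]" "1 < t"
  shows "{x \<in> bipyramid_graph a b c d e. t \<le> peak a b c d e x} =
         (\<Union>v\<in>{a, b, c}. partial_edge d v ((3 - t) / 2))"
proof -
  have *: "x \<in> partial_edge v w 1 \<and> t \<le> peak a b c d e x \<longleftrightarrow>
      w = d \<and> x \<in> partial_edge d v ((3 - t) / 2)"
    if vw: "v \<in> {a, b, c}" "w \<in> {a, b, c, d, e}" "w \<noteq> v" for x v w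
  proof (cases "w = d")
    case True
    have "x \<in> partial_edge v d 1 \<and> t \<le> 1 + 2 * x $ d \<longleftrightarrow> x \<in> partial_edge d v ((3 - t) / 2)"
      using assms(2) by (auto simp: partial_edge_def)
    then show ?thesis using True peak_on_edge[OF assms(1) vw] by auto
  next
    case False
    have "\<not> t \<le> peak a b c d e x" if x: "x \<in> partial_edge v w 1"
      using peak_on_edge[OF assms(1) vw x] False x assms(2) dip_nonneg[of v w x] dip_nonneg[of w v x]
      by (auto simp: partial_edge_def)
    then show ?thesis using False by blast
  qed
  show ?thesis
  proof (rule set_eqI, rule iffI)
    fix x assume "x \<in> {x \<in> bipyramid_graph a b c d e. t \<le> peak a b c d e x}"
    then obtain v w where vw: "v \<in> {a, b, c}" "w \<in> {a, b, c, d, e}" "w \<noteq> v"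
      and x: "x \<in> partial_edge v w 1" "t \<le> peak a b c d e x"
      unfolding bipyramid_graph_def stars_def by blast
    then show "x \<in> (\<Union>v\<in>{a, b, c}. partial_edge d v ((3 - t) / 2))"
      using *[OF vw, of x] by blast
  next
    fix x assume "x \<in> (\<Union>v\<in>{a, b, c}. partial_edge d v ((3 - t) / 2))"
    then obtain v where v: "v \<in> {a, b, c}" and x: "x \<in> partial_edge d v ((3 - t) / 2)" by blast
    have d: "d \<in> {a, b, c, d, e}" "d \<noteq> v" using v assms(1) by auto
    have "x \<in> partial_edge v d 1" "t \<le> peak a b c d e x" using *[OF v d, of x] x by blast+
    then show "x \<in> {x \<in> bipyramid_graph a b c d e. t \<le> peak a b c d e x}"
      using v d unfolding bipyramid_graph_def stars_def by blast
  qed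
qed

lemma dip_le_1: "x $ v = 1 - x $ w \<Longrightarrow> dip v w x \<le> 1"
  by (auto simp: dip_def max_def min_def)

lemma peak_nonneg:
  assumes "distinct [a, b, c, d, e]" "x \<in> bipyramid_graph a b c d e"
  shows "0 \<le> peak a b c d e x"
proof -
  obtain v w where vw: "v \<in> {a, b, c}" "w \<in> {a, b, c, d, e}" "w \<noteq> v"
    and x: "x \<in> partial_edge v w 1"
    using assms(2) unfolding bipyramid_graph_def stars_def by blast
  have "0 \<le> x $ w" "x $ w \<le> 1" "dip v w x \<le> 1" "dip w v x \<le> 1"
    using x dip_le_1[of x v w] dip_le_1[of x w v] by (auto simp: partial_edge_def)
  then show ?thesis using peak_on_edge[OF assms(1) vw x] by auto
qed

lemma unimodal_peak:
  assumes "distinct [a, b, c, d, e]"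
  shows "unimodal (top_of_set (bipyramid_graph a b c d e)) (peak a b c d e)"
proof -
  let ?X = "bipyramid_graph a b c d e" and ?u = "peak a b c d e"
  have "AR {x \<in> ?X. t \<le> ?u x}" if t: "0 < t" "t \<le> 3" for t
  proof (cases "t \<le> 1")
    case True
    have "AR (stars {a, b, c} {a, b, c, d, e} (reach a b c d e (1 - t)))"
    proof (rule AR_stars[where d = d])
      show "d \<notin> {a, b, c}" "d \<in> {a, b, c, d, e}" using assms by auto
    qed (use reach_bounds[OF assms, of "1 - t"] reach_simps(3)[OF assms] t True in \<open>simp_all del: insert_iff\<close>)
    then show ?thesis using peak_superlevel_low[OF assms True t(1)] by simp
  next
    case False
    have "AR (\<Union>v\<in>{a, b, c}. partial_edge d v ((3 - t) / 2))"
    proof (rule AR_star)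
      show "d \<notin> {a, b, c}" using assms by auto
    qed (use t in simp_all)
    then show ?thesis using peak_superlevel_high[OF assms, of t] False by simp
  qed
  then have low: "{x \<in> ?X. t \<le> ?u x} \<noteq> {} \<and> contractible {x \<in> ?X. t \<le> ?u x}"
    if "0 < t" "t \<le> 3" for t
    using that AR_ANR by blast
  have high: "{x \<in> ?X. t \<le> ?u x} = {}" if "3 < t" for t
    using that peak_superlevel_high[OF assms, of t] by (simp add: partial_edge_def)
  have "continuous_map (top_of_set ?X) (top_of_set {0..}) ?u"
    using continuous_on_peak peak_nonneg[OF assms] by (auto simp: image_subset_iff)
  then show ?thesis
    unfolding unimodal_def using low high
    by (intro conjI exI[of _ 3])
       (auto simp: subtopology_subtopology contractible_space_top_of_set Int_absorb1)
qed

section \<open>The realization of the bipyramid\<close>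

lemma convex_hull_edge:
  assumes "v \<noteq> w"
  shows "convex hull (vertex_point ` {v, w}) = partial_edge v w 1"
proof -
  have "x = (1 - x $ w) *\<^sub>R vertex_point v + x $ w *\<^sub>R vertex_point w"
    if "x \<in> partial_edge v w 1" for x
    using partial_edge_point assms that by blast
  moreover have "(1 - s) *\<^sub>R vertex_point v + s *\<^sub>R vertex_point w \<in> partial_edge v w 1"
    if "0 \<le> s" "s \<le> 1" for s
    using that assms by (auto simp: partial_edge_def vertex_point_def axis_def)
  ultimately show ?thesis
    by (fastforce simp: segment_convex_hull[symmetric] closed_segment_def partial_edge_def)
qed

lemma partial_edge_commute: "v \<noteq> w \<Longrightarrow> partial_edge v w 1 = partial_edge w v 1"
  by (auto simp: partial_edge_def)

lemma bipyramid_realization: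
  "graph_realization bipyramid_vertices bipyramid_edges =
     top_of_set (bipyramid_graph Va Vb Vc Vd Ve)"
proof -
  have "vertex_point v \<in> bipyramid_graph Va Vb Vc Vd Ve" for v :: vertex
    by (cases v) (auto simp: bipyramid_graph_def stars_def intro: vertex_point_in_partial_edge
        vertex_point_in_partial_edge' vertex.distinct)
  moreover have "(\<Union>e\<in>bipyramid_edges. convex hull (vertex_point ` e)) =
      bipyramid_graph Va Vb Vc Vd Ve"
    unfolding bipyramid_edges_def bipyramid_graph_def stars_def
    using partial_edge_commute[of Va Vb] partial_edge_commute[of Va Vc] partial_edge_commute[of Vb Vc]
    by (simp add: convex_hull_edge insert_Diff_if del: image_insert) blast
  ultimately show ?thesis
    unfolding graph_realization_def by (metis Un_absorb1 image_subsetI)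
qed

lemma bipyramid_graph_flip: "bipyramid_graph a b c d e = bipyramid_graph b a c e d"
  unfolding bipyramid_graph_def by (simp only: insert_commute)

lemma linear_on_edges_partial_edge:
  assumes "linear_on_edges E f" "{v, w} \<in> E" "v \<noteq> w" "x \<in> partial_edge v w 1"
  shows "f x = (1 - x $ w) * f (vertex_point v) + x $ w * f (vertex_point w)"
proof -
  have "x = (1 - x $ w) *\<^sub>R vertex_point v + x $ w *\<^sub>R vertex_point w"
    using partial_edge_point assms(3,4) by blast
  moreover have "x $ w \<in> {0..1}" using assms(4) by (auto simp: partial_edge_def)
  ultimately show ?thesis using assms(1,2) unfolding linear_on_edges_def by metis
qed

lemma linear_on_bipyramid:
  assumes "linear_on_edges bipyramid_edges f"
    and "f (vertex_point Vd) = 3" "f (vertex_point Ve) = 3"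
    and "f (vertex_point Va) = 1" "f (vertex_point Vb) = 1" "f (vertex_point Vc) = 1"
    and "x \<in> bipyramid_graph Va Vb Vc Vd Ve"
  shows "f x = 1 + 2 * x $ Vd + 2 * x $ Ve"
proof -
  obtain v w where v: "v \<in> {Va, Vb, Vc}" and w: "w \<in> {Va, Vb, Vc, Vd, Ve}" "w \<noteq> v"
    and x: "x \<in> partial_edge v w 1"
    using assms(7) unfolding bipyramid_graph_def stars_def by blast
  have zero: "u \<noteq> v \<longrightarrow> u \<noteq> w \<longrightarrow> x $ u = 0" for u
    using x by (simp add: partial_edge_def)
  have "{v, w} \<in> bipyramid_edges"
    using v w unfolding bipyramid_edges_def
    by (elim insertE emptyE) (simp_all add: insert_commute)
  then have f: "f x = (1 - x $ w) * f (vertex_point v) + x $ w * f (vertex_point w)"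
    using linear_on_edges_partial_edge[OF assms(1)] w(2)[symmetric] x by blast
  have "f (vertex_point v) = 1" using v assms(4-6) by auto
  moreover have "v \<noteq> Vd" "v \<noteq> Ve" using v by auto
  ultimately show ?thesis
    using f zero[of Vd] zero[of Ve] w(1) assms(2-6) by (cases w) (simp_all add: algebra_simps)
qed

section \<open>The two peaks and the lower bound\<close>

text \<open>
  On a base edge one of the two coordinates is at most 1/2, so at least one of the two opposite dips
  vanishes and that function has the value 1; on the edges at an apex one of the two functions is
  at least 1 and the other at most 1.
\<close>
lemma max_peaks:
  assumes "distinct [a, b, c, d, e]" "x \<in> bipyramid_graph a b c d e"
  shows "max (peak a b c d e x) (peak b a c e d x) = 1 + 2 * x $ d + 2 * x $ e"
proof -
  obtain v w where v: "v \<in> {a, b, c}" and w: "w \<in> {a, b, c, d, e}" "w \<noteq> v"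
    and x: "x \<in> partial_edge v w 1"
    using assms(2) unfolding bipyramid_graph_def stars_def by blast
  have perm: "v \<in> {b, a, c}" "w \<in> {b, a, c, e, d}" "distinct [b, a, c, e, d]"
    using v w assms(1) by auto
  note peaks = peak_on_edge[OF assms(1) v w x] peak_on_edge[OF perm(3,1,2) w(2) x]
  have zero: "x $ u = 0" if "u \<noteq> v" "u \<noteq> w" for u
    using x that by (simp add: partial_edge_def)
  have "x $ v = 1 - x $ w" "0 \<le> x $ w" using x by (simp_all add: partial_edge_def)
  then have "x $ v \<le> 1 / 2 \<or> x $ w \<le> 1 / 2" by linarith
  then have dips: "max (1 - dip v w x) (1 - dip w v x) = 1"
    using dip_eq_0[of x v w] dip_eq_0[of x w v] dip_nonneg[of v w x] dip_nonneg[of w v x] by auto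
  have vde: "v \<noteq> d" "v \<noteq> e" "d \<noteq> e" using v assms(1) by auto
  consider "w = d" | "w = e" | "(v, w) \<in> {(a, b), (b, c), (c, a)}"
    | "(w, v) \<in> {(a, b), (b, c), (c, a)}"
    using v w by blast
  then show ?thesis
  proof cases
    case 1
    then show ?thesis using peaks zero[of e] vde \<open>0 \<le> x $ w\<close> by simp
  next
    case 2
    then show ?thesis using peaks zero[of d] vde \<open>0 \<le> x $ w\<close> by simp
  next
    case 3
    then have "w \<noteq> d" "w \<noteq> e" "(v, w) \<notin> {(b, a), (a, c), (c, b)}" using assms(1) by auto
    then show ?thesis using peaks 3 dips zero[of d] zero[of e] vde by (simp del: insert_iff)
  next
    case 4
    then have "w \<noteq> d" "w \<noteq> e" "(v, w) \<notin> {(a, b), (b, c), (c, a)}"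
      "(v, w) \<in> {(b, a), (a, c), (c, b)}" using assms(1) by auto
    then show ?thesis using peaks dips zero[of d] zero[of e] vde
      by (simp del: insert_iff add: max.commute)
  qed
qed

text \<open>
  The superlevel set at level \<^term>\<open>m\<close> contains \<^term>\<open>p\<close> and \<^term>\<open>q\<close>. If it were contractible,
  it would be connected, and by the intermediate value theorem for the coordinate \<^term>\<open>k\<close> it would
  contain a point with coordinate \<^term>\<open>s\<close>.
\<close>
lemma not_unimodal_two_maxima:
  fixes X :: "(real ^ 'n) set"
  assumes "unimodal (top_of_set X) u" "p \<in> X" "q \<in> X"
    and "0 < m" "u p = m" "u q = m"
    and "p $ k < s" "s < q $ k" "\<And>x. x \<in> X \<Longrightarrow> x $ k = s \<Longrightarrow> u x < m"
  shows False
proof -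
  let ?S = "{x \<in> X. m \<le> u x}"
  obtain M where "\<And>c. (0 < c \<and> c \<le> M \<longrightarrow>
       contractible_space (subtopology (top_of_set X) {x \<in> X. c \<le> u x})) \<and>
       (c > M \<longrightarrow> {x \<in> X. c \<le> u x} = {})"
    using assms(1) unfolding unimodal_def by auto
  moreover have "p \<in> ?S" "q \<in> ?S" using assms(2-6) by auto
  ultimately have "contractible_space (subtopology (top_of_set X) ?S)"
    using assms(4) by (metis empty_iff linorder_not_le)
  then have "connected ?S"
    by (simp add: subtopology_subtopology Int_absorb1 contractible_imp_path_connected path_connected_imp_connected)
  then obtain z where "z \<in> ?S" "z $ k = s"
    using connected_ivt_component_cart[of ?S p q k s] \<open>p \<in> ?S\<close> \<open>q \<in> ?S\<close> assms(7,8) by force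
  then show False using assms(9)[of z] by auto
qed

theorem proposition4p9:
  fixes f :: "real ^ vertex \<Rightarrow> real"
  assumes "linear_on_edges bipyramid_edges f"
    and "f (vertex_point Vd) = 3" and "f (vertex_point Ve) = 3"
    and "f (vertex_point Va) = 1" and "f (vertex_point Vb) = 1" and "f (vertex_point Vc) = 1"
  shows "ucat_infty (graph_realization bipyramid_vertices bipyramid_edges) f = 2"
proof -
  let ?X = "bipyramid_graph Va Vb Vc Vd Ve"
  let ?ok = "\<lambda>n. \<exists>u :: nat \<Rightarrow> real ^ vertex \<Rightarrow> real.
    (\<forall>i\<in>{1..n}. unimodal (top_of_set ?X) (u i)) \<and>
    (\<forall>x\<in>?X. f x = Max (insert 0 ((\<lambda>i. u i x) ` {1..n})))"
  have f: "f x = 1 + 2 * x $ Vd + 2 * x $ Ve" if "x \<in> ?X" for x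
    using linear_on_bipyramid[OF assms that] .
  have two: "?ok 2"
  proof (intro exI conjI ballI)
    let ?u = "\<lambda>i::nat. if i = 1 then peak Va Vb Vc Vd Ve else peak Vb Va Vc Ve Vd"
    show "unimodal (top_of_set ?X) (?u i)" for i
      using unimodal_peak[of Va Vb Vc Vd Ve] unimodal_peak[of Vb Va Vc Ve Vd]
        bipyramid_graph_flip[of Va Vb Vc Vd Ve] by simp
    fix x assume x: "x \<in> ?X"
    have "{1..2::nat} = {1, 2}" by auto
    then have "Max (insert 0 ((\<lambda>i. ?u i x) ` {1..2})) =
        max 0 (max (peak Va Vb Vc Vd Ve x) (peak Vb Va Vc Ve Vd x))"
      by simp
    also have "\<dots> = max (peak Va Vb Vc Vd Ve x) (peak Vb Va Vc Ve Vd x)"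
      using peak_nonneg[of Va Vb Vc Vd Ve x] x by simp
    finally show "f x = Max (insert 0 ((\<lambda>i. ?u i x) ` {1..2}))"
      using max_peaks[of Va Vb Vc Vd Ve x] x f by simp
  qed
  have tops: "vertex_point Vd \<in> ?X" "vertex_point Ve \<in> ?X"
    using vertex_point_in_partial_edge'[of Va Vd 1] vertex_point_in_partial_edge'[of Va Ve 1]
    unfolding bipyramid_graph_def stars_def by blast+
  have at_least_two: "2 \<le> n" if n: "?ok n" for n
  proof (rule ccontr)
    assume "\<not> 2 \<le> n"
    then consider "n = 0" | "n = 1" by linarith
    then show False
    proof cases
      case 1
      then have "f (vertex_point Vd) = 0" using n tops(1) by simp
      then show False using assms(2) by simp
    next
      case 2
      then obtain u where u: "unimodal (top_of_set ?X) u" "\<And>x. x \<in> ?X \<Longrightarrow> f x = max 0 (u x)"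
        using n by auto
      have "u x = f x" if "x \<in> ?X" for x
      proof -
        have "0 \<le> u x" using u(1) that unfolding unimodal_def by auto
        then show ?thesis using u(2)[OF that] by simp
      qed
      \<comment> \<open>No edge joins the apices, so a point with positive coordinate at one of them has
        coordinate 0 at the other.\<close>
      moreover have "f x < 3" if x: "x \<in> ?X" "x $ Vd = 1 / 2" for x
      proof -
        have "x $ Ve = 0"
          using x unfolding bipyramid_graph_def stars_def partial_edge_def by auto
        then show ?thesis using f[OF x(1)] x(2) by simp
      qed
      ultimately show False
        using not_unimodal_two_maxima[OF u(1) tops(2,1), of 3 Vd "1 / 2"] tops assms(2,3)
        by (simp add: vertex_point_def axis_def)
    qed
  qed
  have "Inf {enat n | n. ?ok n} = enat 2"
  proof (rule antisym)
    show "Inf {enat n | n. ?ok n} \<le> enat 2"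
      using two by (intro Inf_lower) blast
    have "enat 2 \<le> enat n" if "?ok n" for n
      using at_least_two[OF that] by (simp only: enat_ord_simps)
    then show "enat 2 \<le> Inf {enat n | n. ?ok n}"
      by (intro Inf_greatest) blast
  qed
  also have "enat 2 = 2" by (simp add: numeral_eq_enat)
  finally show ?thesis
    unfolding ucat_infty_def bipyramid_realization topspace_euclidean_subtopology .
qed

end
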